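(* Let $n,p\ge 1$ be integers, let $L\ge m>0$ be arbitrary but fixed, and let $A\in\mathbb{R}^{np\times np}$, $B\in\mathbb{R}^{np\times p}$, $C\in\mathbb{R}^{p\times np}$, $D\in\mathbb{R}^{p\times np}$ be given. Consider, for $H\in\mathcal{S}_{m,L}$, the algorithm $$x_{k+1}=Ax_k+B\nabla H(Cx_k),\qquad z_k=Dx_k .$$ Assume that the pair $(A,C)$ or the pair $(A,D)$ is observable. Then the following are equivalent: (i) for every $H\in\mathcal{S}_{m,L}$ (with domain $\mathbb{R}^p$), with unique minimizer denoted $z^\star$, the algorithm has an equilibrium $x^\star\in\mathbb{R}^{np}$ (i.e. $x^\star=Ax^\star+B\nabla H(Cx^\star)$) with the property $Dx^\star=Cx^\star=z^\star$; (ii) there exists $D^\dagger\in\mathbb{R}^{np\times p}$ such that $$DD^\dagger=I_p,\qquad CD^\dagger=I_p,\qquad (A-I)D^\dagger=0_{np\times p}.$$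
   Context: For $L\ge m\ge 0$, $\mathcal{S}_{m,L}$ is the class of functions $H:\mathbb{R}^p\to\mathbb{R}$, $H\in\mathcal{C}^2$, such that for all $x,y\in\mathbb{R}^p$: $(\nabla H(x)-\nabla H(y))^\top(x-y)\ge m\|x-y\|^2$ and $\|\nabla H(x)-\nabla H(y)\|\le L\|x-y\|$. If $m>0$, every $H\in\mathcal{S}_{m,L}$ has a unique global minimizer. *)

theory Defs
  imports "HOL-Analysis.Analysis"
begin

definition grad :: "('a::real_inner \<Rightarrow> real) \<Rightarrow> 'a \<Rightarrow> 'a" where
  "grad f x = (THE g. GDERIV f x :> g)"

lemma grad_eqI:
  assumes "GDERIV f x :> g"
  shows "grad f x = g"
  unfolding grad_def
proof (rule the_equality)
  show "GDERIV f x :> g" by (fact assms)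
next
  fix g' assume "GDERIV f x :> g'"
  then have "(\<lambda>h. h \<bullet> g') = (\<lambda>h. h \<bullet> g)"
    using assms unfolding gderiv_def by (rule has_derivative_unique)
  then have "(g' - g) \<bullet> (g' - g) = 0"
    by (metis inner_diff_right right_minus_eq)
  then show "g' = g"
    by simp
qed

text \<open>\<open>h x\<close> is the Hessian matrix of \<open>f\<close> at \<open>x\<close>.\<close>

definition C2 :: "(real^'p \<Rightarrow> real) \<Rightarrow> bool" where
  "C2 f \<longleftrightarrow> (\<exists>g h.
     (\<forall>x. GDERIV f x :> g x) \<and>
     (\<forall>x. (g has_derivative (\<lambda>v. h x *v v)) (at x)) \<and>
     continuous_on UNIV h)"

lemma C2_grad:
  assumes "C2 f"
  shows "GDERIV f x :> grad f x"
  using assms unfolding C2_def by (metis grad_eqI)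

definition S_class :: "real \<Rightarrow> real \<Rightarrow> (real^'p \<Rightarrow> real) set" where
  "S_class m L = {H. C2 H \<and>
     (\<forall>x y. (grad H x - grad H y) \<bullet> (x - y) \<ge> m * (norm (x - y))\<^sup>2 \<and>
            norm (grad H x - grad H y) \<le> L * norm (x - y))}"

definition minimizer :: "('a \<Rightarrow> real) \<Rightarrow> 'a" where
  "minimizer H = (THE z. is_arg_min H (\<lambda>_. True) z)"

text \<open>The next lemma shows that \<open>minimizer\<close> is well defined on \<open>S_class m L\<close> when \<open>m > 0\<close>.\<close>

lemma S_class_ex1_minimizer:
  fixes H :: "real^'p \<Rightarrow> real"
  assumes m: "m > 0" and H: "H \<in> S_class m L"
  shows "\<exists>!z. is_arg_min H (\<lambda>_. True) z"
proof -
  have der: "(H has_derivative (\<lambda>h. h \<bullet> grad H x)) (at x)" for x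
    using H C2_grad unfolding S_class_def gderiv_def by blast
  have mono: "(grad H x - grad H y) \<bullet> (x - y) \<ge> m * (norm (x - y))\<^sup>2" for x y
    using H unfolding S_class_def by blast
  have mvt: "\<exists>t. a < t \<and> t < b \<and> H (b *\<^sub>R x) - H (a *\<^sub>R x) = (b - a) * (x \<bullet> grad H (t *\<^sub>R x))"
    if "a < b" for a b :: real and x
  proof -
    have d: "((\<lambda>t. H (t *\<^sub>R x)) has_derivative (\<lambda>s. (s *\<^sub>R x) \<bullet> grad H (t *\<^sub>R x))) (at t within {a..b})" for t
      by (rule has_derivative_compose[where f="\<lambda>t. t *\<^sub>R x", OF _ der])
         (auto intro!: derivative_eq_intros)
    have "\<exists>t\<in>{a<..<b}. H (b *\<^sub>R x) - H (a *\<^sub>R x) = ((b - a) *\<^sub>R x) \<bullet> grad H (t *\<^sub>R x)"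
      by (rule mvt_simple[OF \<open>a < b\<close>]) (use d in auto)
    then show ?thesis by auto
  qed
  have low: "x \<bullet> grad H (t *\<^sub>R x) \<ge> x \<bullet> grad H 0 + m * t * (norm x)\<^sup>2" if "t > 0" for t x
  proof -
    have "t * (x \<bullet> grad H (t *\<^sub>R x) - x \<bullet> grad H 0) \<ge> t * (m * t * (norm x)\<^sup>2)"
      using mono[of "t *\<^sub>R x" 0] that
      by (simp add: inner_diff_left inner_commute power_mult_distrib power2_eq_square algebra_simps)
    then show ?thesis using that by simp
  qed
  have coer: "H x \<ge> H 0 + x \<bullet> grad H 0 + m / 4 * (norm x)\<^sup>2" for x
  proof -
    obtain s where s: "1/2 < s" "H x - H ((1/2) *\<^sub>R x) = (1/2) * (x \<bullet> grad H (s *\<^sub>R x))"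
      using mvt[of "1/2" 1 x] by auto
    obtain t where t: "0 < t" "H ((1/2) *\<^sub>R x) - H 0 = (1/2) * (x \<bullet> grad H (t *\<^sub>R x))"
      using mvt[of 0 "1/2" x] by auto
    have "m * s * (norm x)\<^sup>2 \<ge> m * (1/2) * (norm x)\<^sup>2" "m * t * (norm x)\<^sup>2 \<ge> 0"
      by (rule mult_right_mono; use s m in simp) (use t m in simp)
    with low[of s x] low[of t x] s t show ?thesis by simp
  qed
  define R where "R = 4 * norm (grad H 0) / m"
  have out: "H x \<ge> H 0" if "norm x \<ge> R" for x
  proof -
    have "norm (grad H 0) \<le> m / 4 * norm x"
      using that m by (simp add: R_def field_simps)
    then have "norm x * norm (grad H 0) \<le> m / 4 * (norm x)\<^sup>2"
      using mult_left_mono[of _ _ "norm x"] by (fastforce simp: power2_eq_square algebra_simps)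
    moreover have "x \<bullet> grad H 0 \<ge> - (norm x * norm (grad H 0))"
      using Cauchy_Schwarz_ineq2[of x "grad H 0"] by linarith
    ultimately show ?thesis using coer[of x] by linarith
  qed
  have "R \<ge> 0" using m by (simp add: R_def)
  have "continuous_on (cball 0 R) H"
    using der by (meson has_derivative_continuous continuous_at_imp_continuous_on)
  then obtain z where z: "\<forall>y\<in>cball 0 R. H z \<le> H y"
    using continuous_attains_inf[of "cball 0 R" H] \<open>R \<ge> 0\<close> by auto
  have "H z \<le> H y" for y
  proof (cases "norm y \<le> R")
    case False
    have "H z \<le> H 0" using z \<open>R \<ge> 0\<close> by auto
    then show ?thesis using out[of y] False by linarith
  qed (use z in auto)
  then have ex: "is_arg_min H (\<lambda>_. True) z"
    by (auto simp: is_arg_min_linorder)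
  have zero: "grad H w = 0" if "is_arg_min H (\<lambda>_. True) w" for w
  proof -
    have "(\<lambda>h. h \<bullet> grad H w) = (\<lambda>v. 0)"
      by (rule differential_zero_maxmin[of w UNIV H, OF _ _ der])
         (use that in \<open>auto simp: is_arg_min_linorder\<close>)
    then show ?thesis by (metis inner_eq_zero_iff)
  qed
  show ?thesis
  proof (rule ex1I)
    show "is_arg_min H (\<lambda>_. True) z" by (fact ex)
  next
    fix w assume "is_arg_min H (\<lambda>_. True) w"
    then have "m * (norm (w - z))\<^sup>2 \<le> 0"
      using mono[of w z] zero ex by simp
    then show "w = z" using m by (simp add: mult_le_0_iff)
  qed
qed

text \<open>Observability of the pair \<open>(A, C)\<close>: the initial state of \<open>x (k+1) = A (x k)\<close> is uniquely
  determined by the output sequence \<open>C (x k)\<close>. Here \<open>((*v) A ^^ k) x\<close> is \<open>A\<close> applied \<open>k\<close> times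
  to \<open>x\<close>.\<close>

definition observable :: "real^'s^'s \<Rightarrow> real^'s^'p \<Rightarrow> bool" where
  "observable A C \<longleftrightarrow>
     (\<forall>x y. (\<forall>k. C *v (((*v) A ^^ k) x) = C *v (((*v) A ^^ k) y)) \<longrightarrow> x = y)"

end

theory Submission
  imports Defs
begin

text \<open>At an equilibrium with \<open>C x = z\<close>, where \<open>z\<close> is the minimizer of \<open>H\<close>, the gradient term
  vanishes, so \<open>x\<close> is a fixed point of \<open>A\<close>. The quadratics \<open>(m / 2) \<parallel>x - z\<parallel>\<^sup>2\<close> realise every \<open>z\<close> as
  a minimizer; the equilibria obtained for the standard basis vectors are the columns of
  \<open>D\<^sup>\<dagger>\<close>. Conversely, \<open>D\<^sup>\<dagger> z\<close> is an equilibrium for every \<open>H\<close> with minimizer \<open>z\<close>.\<close>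

text \<open>First-order optimality: the derivative vanishes at a global minimum, which exists since
  \<open>m > 0\<close>.\<close>

lemma grad_minimizer_eq_0:
  fixes H :: "real^'p \<Rightarrow> real"
  assumes "m > 0" and H: "H \<in> S_class m L"
  shows "grad H (minimizer H) = 0"
proof -
  have "is_arg_min H (\<lambda>_. True) (minimizer H)"
    unfolding minimizer_def by (rule theI'[OF S_class_ex1_minimizer[OF assms]])
  then have min: "H (minimizer H) \<le> H y" for y
    by (auto simp: is_arg_min_linorder)
  have der: "(H has_derivative (\<lambda>h. h \<bullet> grad H (minimizer H))) (at (minimizer H))"
    using H C2_grad unfolding S_class_def gderiv_def by blast
  have "(\<lambda>h. h \<bullet> grad H (minimizer H)) = (\<lambda>v. 0)"
    by (rule differential_zero_maxmin[of "minimizer H" UNIV H, OF _ _ der]) (use min in auto)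
  then show ?thesis by (metis inner_eq_zero_iff)
qed

definition quadratic :: "real \<Rightarrow> 'a::real_inner \<Rightarrow> 'a \<Rightarrow> real" where
  "quadratic m z x = m / 2 * ((x - z) \<bullet> (x - z))"

lemma GDERIV_quadratic: "GDERIV (quadratic m z) x :> m *\<^sub>R (x - z)"
  unfolding gderiv_def quadratic_def[abs_def]
  by (auto intro!: derivative_eq_intros ext simp: inner_commute algebra_simps)

lemma grad_quadratic: "grad (quadratic m z) x = m *\<^sub>R (x - z)"
  by (rule grad_eqI[OF GDERIV_quadratic])

lemma C2_quadratic: "C2 (quadratic m (z :: real^'p))"
  unfolding C2_def
proof (intro exI conjI allI)
  fix x
  show "GDERIV (quadratic m z) x :> m *\<^sub>R (x - z)"
    by (rule GDERIV_quadratic)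
  \<comment> \<open>The Hessian is \<open>m\<close> times the identity at every point, hence
    continuous in the point.\<close>
  show "((\<lambda>x. m *\<^sub>R (x - z)) has_derivative (\<lambda>v. (m *\<^sub>R mat 1) *v v)) (at x)"
    by (auto intro!: derivative_eq_intros simp flip: scaleR_matrix_vector_assoc)
qed (rule continuous_on_const)

text \<open>The gradient is \<open>m\<close> times a translation, so strong monotonicity holds with
  equality and the Lipschitz constant is \<open>m\<close>, at most \<open>L\<close>.\<close>

lemma quadratic_in_S_class:
  assumes "m > 0" and "L \<ge> m"
  shows "quadratic m (z :: real^'p) \<in> S_class m L"
proof -
  have "grad (quadratic m z) x - grad (quadratic m z) y = m *\<^sub>R (x - y)" for x y
    by (simp add: grad_quadratic algebra_simps)
  then show ?thesis
    using assms by (auto simp: S_class_def C2_quadratic power2_norm_eq_inner intro: mult_right_mono)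
qed

text \<open>The gradient \<open>m *\<^sub>R (x - z)\<close> vanishes only at \<open>z\<close>.
  Membership in the class is taken with \<open>L = m\<close>.\<close>

lemma minimizer_quadratic:
  assumes "m > 0"
  shows "minimizer (quadratic m (z :: real^'p)) = z"
  using grad_minimizer_eq_0[OF assms quadratic_in_S_class[OF assms order_refl], of z] assms
  by (simp add: grad_quadratic)

text \<open>Reduces a matrix identity for the matrix with columns \<open>X j\<close> to one vector
  identity per column.\<close>

lemma matrix_mult_columns:
  fixes M :: "real^'s^'p"
  shows "M ** (\<chi> i j. X j $ i) = (\<chi> i j. (M *v X j) $ i)"
  by (simp add: vec_eq_iff matrix_matrix_mult_def matrix_vector_mult_def)

theorem theorem2:
  fixes n :: nat and m L :: real
    and A :: "real^'s^'s" and B :: "real^'p^'s" and C D :: "real^'s^'p"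
  assumes "n \<ge> 1" and "CARD('s) = n * CARD('p)"
    and "m > 0" and "L \<ge> m"
    and "observable A C \<or> observable A D"
  shows "(\<forall>H \<in> S_class m L. \<exists>xs :: real^'s.
            xs = A *v xs + B *v grad H (C *v xs) \<and>
            D *v xs = minimizer H \<and> C *v xs = minimizer H)
     \<longleftrightarrow> (\<exists>Dd :: real^'p^'s.
            D ** Dd = mat 1 \<and> C ** Dd = mat 1 \<and> (A - mat 1) ** Dd = 0)"
    (is "?eq \<longleftrightarrow> ?mat")
proof
  assume eq: ?eq
  have "\<exists>x. A *v x = x \<and> D *v x = z \<and> C *v x = z" for z
  proof -
    obtain x where "x = A *v x + B *v (m *\<^sub>R (C *v x - z))" "D *v x = z" "C *v x = z"
      using bspec[OF eq quadratic_in_S_class[OF assms(3,4), of z]]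
      unfolding minimizer_quadratic[OF assms(3)] grad_quadratic by blast
    then show ?thesis by (intro exI[of _ x]) simp
  qed
  then obtain X where X: "\<And>z. A *v X z = X z" "\<And>z. D *v X z = z" "\<And>z. C *v X z = z"
    by metis
  \<comment> \<open>\<open>X\<close> is a mere choice function, perhaps not linear, so a matrix is
    built from its values on the basis only.\<close>
  define Dd :: "real^'p^'s" where "Dd = (\<chi> i j. X (axis j 1) $ i)"
  have "D ** Dd = mat 1" "C ** Dd = mat 1"
    by (simp_all add: Dd_def matrix_mult_columns X vec_eq_iff mat_def axis_def)
  moreover have "(A - mat 1) ** Dd = 0"
    by (simp add: Dd_def matrix_mult_columns matrix_vector_mult_diff_rdistrib X vec_eq_iff)
  ultimately show ?mat by blast
next
  assume ?mat
  then obtain Dd :: "real^'p^'s"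
    where Dd: "D ** Dd = mat 1" "C ** Dd = mat 1" "(A - mat 1) ** Dd = 0"
    by blast
  show ?eq
  proof
    fix H :: "real^'p \<Rightarrow> real" assume H: "H \<in> S_class m L"
    define x where "x = Dd *v minimizer H"
    have out: "D *v x = minimizer H" "C *v x = minimizer H"
      by (simp_all add: x_def matrix_vector_mul_assoc Dd)
    have "(A - mat 1) *v x = 0"
      by (simp add: x_def matrix_vector_mul_assoc Dd)
    then have "A *v x = x"
      by (simp add: matrix_vector_mult_diff_rdistrib)
    \<comment> \<open>Since \<open>C *v x\<close> is the minimizer, the gradient there is zero and
      the \<open>B\<close> term drops out.\<close>
    with out show "\<exists>xs. xs = A *v xs + B *v grad H (C *v xs) \<and>
        D *v xs = minimizer H \<and> C *v xs = minimizer H"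
      using grad_minimizer_eq_0[OF assms(3) H] by (intro exI[of _ x]) simp
  qed
qed

end
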